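(* The negative free energy difference provides a variational principle for the equilibrium distribution. That is, for a finite set $\mathcal{X}$, a real parameter $\beta$, a Gibbs measure $p_0$ on $\mathcal{X}$ and a function $U:\mathcal{X}\to\mathbb{R}$, the functional of probability measures $q$ over $\mathcal{X}$ $$-\Delta F[q]:=\sum_{x\in\mathcal{X}}q(x)U(x)-\frac{1}{\beta}\sum_{x\in\mathcal{X}}q(x)\log\frac{q(x)}{p_0(x)}$$ is maximized by $$p(x)=\frac{1}{Z}\,p_0(x)\,e^{\beta U(x)},\qquad\text{where}\quad Z:=\sum_{x\in\mathcal{X}}p_0(x)\,e^{\beta U(x)}.$$ Furthermore, $$-\Delta F[q]\leq-\Delta F[p]=\tfrac{1}{\beta}\log Z.$$
   Context: $\mathcal{X}$ is a measurable partition of a reference event in a finite measurable space. $\beta$ is a real parameter, the resource parameter. $p_0$ and $p$ are the Gibbs measures on $\mathcal{X}$ with real-valued potentials $\phi_0$ and $\phi$ and resource parameter $\beta$, i.e. $p_0(x)=e^{-\beta\phi_0(x)}/\sum_{x'\in\mathcal{X}}e^{-\beta\phi_0(x')}$ and $p(x)=e^{-\beta\phi(x)}/\sum_{x'\in\mathcal{X}}e^{-\beta\phi(x')}$. The gain (or loss) is $U(x)=\phi_0(x)-\phi(x)$, so that $p(x)\propto p_0(x)e^{\beta U(x)}$; this $p$ is called the equilibrium distribution. $\log$ is the natural logarithm.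
   Formalization: The parameter β is assumed nonzero (1/β is undefined at 0), and the maximization and the inequality are claimed only for β > 0, since for β < 0 the inequality reverses; the existence of p and −ΔF[p] = (1/β) log Z are claimed for all β ≠ 0. *)

theory Defs
  imports "HOL-Probability.Probability_Mass_Function"
begin

text \<open>
  A probability measure over a finite set \<open>X\<close> is a PMF \<open>q\<close> with \<open>set_pmf q \<subseteq> X\<close>; in particular,
  the existence of one forces \<open>X\<close> to be nonempty.
\<close>

definition gibbs_measure :: "'a set \<Rightarrow> real \<Rightarrow> ('a \<Rightarrow> real) \<Rightarrow> 'a pmf \<Rightarrow> bool" where
  "gibbs_measure X \<beta> \<phi> p \<longleftrightarrow> set_pmf p \<subseteq> X \<and>
     (\<forall>x\<in>X. pmf p x = exp (- \<beta> * \<phi> x) / (\<Sum>x'\<in>X. exp (- \<beta> * \<phi> x')))"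

definition partition_sum :: "'a set \<Rightarrow> real \<Rightarrow> 'a pmf \<Rightarrow> ('a \<Rightarrow> real) \<Rightarrow> real" where
  "partition_sum X \<beta> p0 U = (\<Sum>x\<in>X. pmf p0 x * exp (\<beta> * U x))"

text \<open>
  Where \<open>q\<close> vanishes, the logarithmic term is \<open>0 * ln 0 = 0\<close>, the usual convention. For a Gibbs
  measure \<open>p0\<close> on \<open>X\<close> the quotient never has a zero denominator.
\<close>

definition neg_free_energy_diff ::
    "'a set \<Rightarrow> real \<Rightarrow> 'a pmf \<Rightarrow> ('a \<Rightarrow> real) \<Rightarrow> 'a pmf \<Rightarrow> real" where
  "neg_free_energy_diff X \<beta> p0 U q =
     (\<Sum>x\<in>X. pmf q x * U x) - 1 / \<beta> * (\<Sum>x\<in>X. pmf q x * ln (pmf q x / pmf p0 x))"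

end

theory Submission
  imports Defs
begin

text \<open>
  Let \<open>p\<close> be the exponential tilt of \<open>p0\<close>, with density \<open>exp (\<beta> * U x) / Z\<close>. Taking logarithms,
  \<open>\<beta> * U x = ln (p x / p0 x) + ln Z\<close>, so the energy term of the functional at any \<open>q\<close> can be absorbed
  into its entropy term. What is left is \<open>1 / \<beta> * (ln Z - D q)\<close>, where \<open>D q\<close> is the relative
  entropy of \<open>q\<close> with respect to \<open>p\<close> (lemma \<open>neg_free_energy_diff_eq\<close>). Hence the dependence on \<open>q\<close>
  is only through \<open>D q\<close>, which vanishes at \<open>q = p\<close> and is nonnegative everywhere
  (lemma \<open>relative_entropy_nonneg\<close>). The former gives the value of the functional at \<open>p\<close> for either
  sign of \<open>\<beta>\<close>; the latter shows, for \<open>\<beta> > 0\<close>, that this value is the maximum.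
  For \<open>\<beta> < 0\<close> the same identity makes \<open>p\<close> a minimizer, which is why the
  extremality claim carries the sign condition.
\<close>

lemma gibbs_measure_pos:
  assumes "finite X" "gibbs_measure X \<beta> \<phi> p" "x \<in> X"
  shows "pmf p x > 0"
proof -
  have "(\<Sum>x'\<in>X. exp (- \<beta> * \<phi> x')) > 0"
    using assms by (intro sum_pos) auto
  then show ?thesis
    using assms by (simp add: gibbs_measure_def)
qed

text \<open>
  Gibbs' inequality. Where \<open>q x > 0\<close>, the bound \<open>ln t \<le> t - 1\<close> at \<open>t = p x / q x\<close> makes the summand
  at least \<open>q x - p x\<close>; elsewhere this is \<open>0 \<ge> - p x\<close>. Over \<open>X\<close> the measure \<open>q\<close> sums to one while \<open>p\<close> sums to at most one.
\<close>

lemma relative_entropy_nonneg: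
  assumes "finite X" "set_pmf q \<subseteq> X" "set_pmf q \<subseteq> set_pmf p"
  shows "(\<Sum>x\<in>X. pmf q x * ln (pmf q x / pmf p x)) \<ge> 0"
proof -
  have termwise: "pmf q x - pmf p x \<le> pmf q x * ln (pmf q x / pmf p x)" for x
  proof (cases "x \<in> set_pmf q")
    case True
    then have q: "pmf q x > 0" and p: "pmf p x > 0"
      using assms(3) by (auto intro: pmf_positive)
    have "ln (pmf p x / pmf q x) \<le> pmf p x / pmf q x - 1"
      using p q by (intro ln_le_minus_one) simp
    then have "pmf q x * ln (pmf p x / pmf q x) \<le> pmf q x * (pmf p x / pmf q x - 1)"
      using q by (intro mult_left_mono) auto
    also have "\<dots> = pmf p x - pmf q x"
      using q by (simp add: field_simps)
    finally show ?thesis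
      using p q by (simp add: ln_div algebra_simps)
  next
    case False
    then show ?thesis
      by (simp add: set_pmf_iff)
  qed
  have "(\<Sum>x\<in>X. pmf q x) = 1"
    using assms by (intro sum_pmf_eq_1) auto
  moreover have "(\<Sum>x\<in>X. pmf p x) \<le> 1"
    using assms(1) by (simp flip: measure_measure_pmf_finite)
  ultimately have "0 \<le> (\<Sum>x\<in>X. pmf q x - pmf p x)"
    by (simp add: sum_subtractf)
  also have "\<dots> \<le> (\<Sum>x\<in>X. pmf q x * ln (pmf q x / pmf p x))"
    by (intro sum_mono termwise)
  finally show ?thesis .
qed

lemma exponential_tilt_exists:
  assumes "finite X" "partition_sum X \<beta> p0 U > 0"
  obtains p where "set_pmf p \<subseteq> X"
    and "\<And>x. x \<in> X \<Longrightarrow> pmf p x = 1 / partition_sum X \<beta> p0 U * pmf p0 x * exp (\<beta> * U x)"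
proof -
  define Z where "Z = partition_sum X \<beta> p0 U"
  define f where "f x = (if x \<in> X then 1 / Z * pmf p0 x * exp (\<beta> * U x) else 0)" for x
  have Z: "Z > 0"
    using assms(2) by (simp add: Z_def)
  have nonneg: "f x \<ge> 0" for x
    using Z by (simp add: f_def)
  have "(\<integral>\<^sup>+x. ennreal (f x) \<partial>count_space UNIV) = (\<Sum>x\<in>X. ennreal (f x))"
    using assms(1) by (intro nn_integral_count_space') (auto simp: f_def)
  also have "\<dots> = ennreal (\<Sum>x\<in>X. f x)"
    using nonneg by (intro sum_ennreal) auto
  also have "(\<Sum>x\<in>X. f x) = (\<Sum>x\<in>X. pmf p0 x * exp (\<beta> * U x)) / Z"
    by (simp add: f_def sum_divide_distrib)
  also have "\<dots> = 1"
    using Z by (simp add: Z_def partition_sum_def)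
  finally have total: "(\<integral>\<^sup>+x. ennreal (f x) \<partial>count_space UNIV) = 1"
    by simp
  have pmf_f: "pmf (embed_pmf f) x = f x" for x
    using nonneg total by (rule pmf_embed_pmf)
  show ?thesis
  proof (rule that)
    show "set_pmf (embed_pmf f) \<subseteq> X"
      by (auto simp: set_pmf_iff pmf_f f_def split: if_splits)
    show "pmf (embed_pmf f) x = 1 / partition_sum X \<beta> p0 U * pmf p0 x * exp (\<beta> * U x)"
      if "x \<in> X" for x
      using that by (simp add: pmf_f f_def Z_def)
  qed
qed

text \<open>
  This is the change of reference measure from \<open>p0\<close> to its tilt \<open>p\<close>: the logarithm of the density
  between them is \<open>\<beta> * U x - ln Z\<close>, so that the energy cancels and the constant \<open>ln Z\<close> comes out
  weighted by the total mass of \<open>q\<close>.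
\<close>

lemma neg_free_energy_diff_eq:
  assumes "finite X" "\<beta> \<noteq> 0" "set_pmf q \<subseteq> X" "set_pmf q \<subseteq> set_pmf p0"
    and Z: "partition_sum X \<beta> p0 U > 0"
    and p: "\<And>x. x \<in> X \<Longrightarrow> pmf p x = 1 / partition_sum X \<beta> p0 U * pmf p0 x * exp (\<beta> * U x)"
  shows "neg_free_energy_diff X \<beta> p0 U q =
    1 / \<beta> * (ln (partition_sum X \<beta> p0 U) - (\<Sum>x\<in>X. pmf q x * ln (pmf q x / pmf p x)))"
proof -
  define Z where "Z = partition_sum X \<beta> p0 U"
  have "pmf q x * ln (pmf q x / pmf p0 x) =
      \<beta> * (pmf q x * U x) - pmf q x * ln Z + pmf q x * ln (pmf q x / pmf p x)"
    if "x \<in> X" for x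
  proof (cases "x \<in> set_pmf q")
    case True
    then have pos: "pmf q x > 0" "pmf p0 x > 0" "Z > 0"
      using assms(4) Z by (auto intro: pmf_positive simp: Z_def)
    have "ln (pmf p x) = ln (pmf p0 x) + \<beta> * U x - ln Z"
      using pos p[OF that] by (simp add: Z_def[symmetric] ln_div ln_mult)
    moreover have "pmf p x > 0"
      using pos p[OF that] by (simp add: Z_def[symmetric])
    ultimately have "ln (pmf q x / pmf p0 x) = \<beta> * U x - ln Z + ln (pmf q x / pmf p x)"
      using pos by (simp add: ln_div)
    then show ?thesis
      by (simp only:) (simp add: algebra_simps)
  next
    case False
    then show ?thesis
      by (simp add: set_pmf_iff)
  qed
  then have "(\<Sum>x\<in>X. pmf q x * ln (pmf q x / pmf p0 x)) =
      \<beta> * (\<Sum>x\<in>X. pmf q x * U x) - (\<Sum>x\<in>X. pmf q x) * ln Z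
        + (\<Sum>x\<in>X. pmf q x * ln (pmf q x / pmf p x))"
    by (simp add: sum.distrib sum_subtractf sum_distrib_left sum_distrib_right)
  moreover have "(\<Sum>x\<in>X. pmf q x) = 1"
    using assms by (intro sum_pmf_eq_1) auto
  ultimately show ?thesis
    using \<open>\<beta> \<noteq> 0\<close> by (simp add: neg_free_energy_diff_def Z_def field_simps)
qed

theorem corollary3:
  fixes X :: "'a set" and \<beta> :: real and \<phi>0 U :: "'a \<Rightarrow> real" and p0 :: "'a pmf"
  assumes "finite X"
    and "\<beta> \<noteq> 0"
    and "gibbs_measure X \<beta> \<phi>0 p0"
  shows "\<exists>p. set_pmf p \<subseteq> X \<and>
    (\<forall>x\<in>X. pmf p x = 1 / partition_sum X \<beta> p0 U * pmf p0 x * exp (\<beta> * U x)) \<and>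
    neg_free_energy_diff X \<beta> p0 U p = 1 / \<beta> * ln (partition_sum X \<beta> p0 U) \<and>
    (\<beta> > 0 \<longrightarrow>
      is_arg_max (neg_free_energy_diff X \<beta> p0 U) (\<lambda>q. set_pmf q \<subseteq> X) p \<and>
      (\<forall>q. set_pmf q \<subseteq> X \<longrightarrow>
        neg_free_energy_diff X \<beta> p0 U q \<le> neg_free_energy_diff X \<beta> p0 U p))"
proof -
  have p0_pos: "pmf p0 x > 0" if "x \<in> X" for x
    using assms that by (intro gibbs_measure_pos)
  then have X_sub: "X \<subseteq> set_pmf p0"
    by (force simp: set_pmf_iff)
  have "X \<noteq> {}"
    using assms(3) set_pmf_not_empty[of p0] by (auto simp: gibbs_measure_def)
  then have Z: "partition_sum X \<beta> p0 U > 0"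
    unfolding partition_sum_def using assms(1) p0_pos by (intro sum_pos) auto
  obtain p where p_sub: "set_pmf p \<subseteq> X"
    and p: "\<And>x. x \<in> X \<Longrightarrow> pmf p x = 1 / partition_sum X \<beta> p0 U * pmf p0 x * exp (\<beta> * U x)"
    using exponential_tilt_exists[OF assms(1) Z] by blast
  have p_supp: "X \<subseteq> set_pmf p"
    using p p0_pos Z by (force simp: set_pmf_iff)
  have F: "neg_free_energy_diff X \<beta> p0 U q =
      1 / \<beta> * (ln (partition_sum X \<beta> p0 U) - (\<Sum>x\<in>X. pmf q x * ln (pmf q x / pmf p x)))"
    if "set_pmf q \<subseteq> X" for q
    using neg_free_energy_diff_eq[OF assms(1,2) that _ Z p] that X_sub by blast
  have "pmf p x * ln (pmf p x / pmf p x) = 0" for x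
    by (cases "pmf p x = 0") auto
  then have value_p: "neg_free_energy_diff X \<beta> p0 U p = 1 / \<beta> * ln (partition_sum X \<beta> p0 U)"
    unfolding F[OF p_sub] by (simp only: sum.neutral_const diff_zero)
  have max: "neg_free_energy_diff X \<beta> p0 U q \<le> neg_free_energy_diff X \<beta> p0 U p"
    if "\<beta> > 0" "set_pmf q \<subseteq> X" for q
  proof -
    have "(\<Sum>x\<in>X. pmf q x * ln (pmf q x / pmf p x)) \<ge> 0"
      using assms(1) that p_supp by (intro relative_entropy_nonneg) auto
    then show ?thesis
      unfolding F[OF that(2)] value_p using that(1) by (intro mult_left_mono) auto
  qed
  show ?thesis
    using p_sub p value_p max by (intro exI[of _ p]) (auto simp: is_arg_max_def not_less)
qed

end
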